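(* Consider the $2$-user symmetric linear deterministic Z interference channel with unidirectional, rate-limited transmitter cooperation of capacity $C$ (a nonnegative integer) from transmitter $2$ to transmitter $1$, with integer parameters $m \ge 1$, $n \ge 0$, and suppose $0 \le \alpha \le 1$, where $\alpha = n/m$. Then the secrecy capacity region (under the perfect secrecy constraint) is the set of all $(R_1,R_2)$ with $R_1 \ge 0$, $R_2 \ge 0$ and $$R_1 \le m,\qquad R_2 \le m,\qquad R_1+R_2 \le 2m-n+C.$$
   Context: Model: let $q=\max\{m,n\}$ and let $\mathbf{D}$ be the $q\times q$ downshift matrix over $\mathbb{F}_2$ (entries $d_{j',j''}=1$ if $2\le j'=j''+1\le q$, and $0$ otherwise). At each channel use, transmitter $i$ sends $\mathbf{x}_i\in\mathbb{F}_2^q$, and the outputs are $\mathbf{y}_1=\mathbf{D}^{q-m}\mathbf{x}_1\oplus\mathbf{D}^{q-n}\mathbf{x}_2$ and $\mathbf{y}_2=\mathbf{D}^{q-m}\mathbf{x}_2$, where $\oplus$ is componentwise addition mod $2$. (Thus transmitter $1$ is not heard at receiver $2$: the channel is a Z-channel.) Transmitter $i$ has a message $W_i$ uniform on $\{1,\dots,2^{NR_i}\}$ ($N$ = block length, rates in bits per channel use). Transmitter $2$ can send to transmitter $1$, over a noiseless secure link, at most $C$ bits per channel use; transmitter $2$'s transmitted signal depends only on $W_2$ (and possibly its own randomness), while transmitter $1$'s signal at each time is a function of $W_1$, the bits received so far over the cooperative link (causality), and possibly locally generated random bits. Receiver $i$ decodes $W_i$ from $\mathbf{y}_i^N$. A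 rate pair is achievable with perfect secrecy if there are such codes with decoding error probability tending to $0$ as $N\to\infty$ and $I(W_i;\mathbf{y}_j^N)=0$ for $i\ne j$, $i,j\in\{1,2\}$. The secrecy capacity region is the closure of the set of achievable rate pairs. *)

theory Defs
  imports "HOL-Probability.Probability"
begin

text \<open>Linear deterministic Z interference channel with unidirectional conferencing
  (transmitter 2 to transmitter 1) of C bits per channel use, perfect secrecy.
  Vectors in F_2^q are indexed 0..q-1 (index j corresponds to row j+1 of the paper),
  represented as functions nat => bool of which only indices j < q are ever read.\<close>

definition qdim :: "nat \<Rightarrow> nat \<Rightarrow> nat" where
  "qdim m n = max m n"

text \<open>Component j of D^k x, D the q x q downshift matrix: (D x)_1 = 0, (D x)_{j+1} = x_j.\<close>
definition dshift :: "nat \<Rightarrow> (nat \<Rightarrow> bool) \<Rightarrow> nat \<Rightarrow> bool" where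
  "dshift k x j = (if j < k then False else x (j - k))"

definition out1 :: "nat \<Rightarrow> nat \<Rightarrow> (nat \<Rightarrow> bool) \<Rightarrow> (nat \<Rightarrow> bool) \<Rightarrow> bool list" where
  "out1 m n x1 x2 = map (\<lambda>j. dshift (qdim m n - m) x1 j \<noteq> dshift (qdim m n - n) x2 j) [0..<qdim m n]"

definition out2 :: "nat \<Rightarrow> nat \<Rightarrow> (nat \<Rightarrow> bool) \<Rightarrow> bool list" where
  "out2 m n x2 = map (\<lambda>j. dshift (qdim m n - m) x2 j) [0..<qdim m n]"

text \<open>A code of block length N.
  Message W_i is uniform on {0..<M_i}.  U1, U2 are the local randomness of the
  transmitters (arbitrary distributions on nat, independent of each other and of the messages).
  Transmitter 2: x_2 at time t is enc2 W2 U2 t; the cooperative link message at time t is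
  link W2 U2 t, a number in {0..<2^C} (i.e. C bits).
  Transmitter 1: x_1 at time t is enc1 W1 (link messages of times < t) U1 t.
  Decoder i maps the output sequence (list of N vectors) to a message estimate.\<close>
record zcode =
  M1 :: nat
  M2 :: nat
  rand1 :: "nat pmf"
  rand2 :: "nat pmf"
  enc2 :: "nat \<Rightarrow> nat \<Rightarrow> nat \<Rightarrow> nat \<Rightarrow> bool"
  link :: "nat \<Rightarrow> nat \<Rightarrow> nat \<Rightarrow> nat"
  enc1 :: "nat \<Rightarrow> nat list \<Rightarrow> nat \<Rightarrow> nat \<Rightarrow> nat \<Rightarrow> bool"
  dec1 :: "bool list list \<Rightarrow> nat"
  dec2 :: "bool list list \<Rightarrow> nat"

definition link_ok :: "nat \<Rightarrow> zcode \<Rightarrow> bool" where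
  "link_ok C c \<longleftrightarrow> (\<forall>w u t. link c w u t < 2 ^ C)"

definition joint :: "nat \<Rightarrow> nat \<Rightarrow> nat \<Rightarrow> zcode \<Rightarrow> (nat \<times> nat \<times> bool list list \<times> bool list list) pmf" where
  "joint m n N c =
     do { w1 \<leftarrow> pmf_of_set {0..<M1 c};
          w2 \<leftarrow> pmf_of_set {0..<M2 c};
          u1 \<leftarrow> rand1 c;
          u2 \<leftarrow> rand2 c;
          let v = map (link c w2 u2) [0..<N];
          let x2 = enc2 c w2 u2;
          let x1 = (\<lambda>t. enc1 c w1 (take t v) u1 t);
          return_pmf (w1, w2,
                      map (\<lambda>t. out1 m n (x1 t) (x2 t)) [0..<N],
                      map (\<lambda>t. out2 m n (x2 t)) [0..<N]) }"

definition err_prob :: "nat \<Rightarrow> nat \<Rightarrow> nat \<Rightarrow> zcode \<Rightarrow> real" where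
  "err_prob m n N c = measure_pmf.prob (joint m n N c)
     {(w1, w2, y1, y2). dec1 c y1 \<noteq> w1 \<or> dec2 c y2 \<noteq> w2}"

definition mi :: "'a pmf \<Rightarrow> ('a \<Rightarrow> 'b::countable) \<Rightarrow> ('a \<Rightarrow> 'c::countable) \<Rightarrow> real" where
  "mi P X Y = prob_space.mutual_information (measure_pmf P) 2 (count_space UNIV) (count_space UNIV) X Y"

definition perfectly_secret :: "nat \<Rightarrow> nat \<Rightarrow> nat \<Rightarrow> zcode \<Rightarrow> bool" where
  "perfectly_secret m n N c \<longleftrightarrow>
     mi (joint m n N c) (\<lambda>(w1, w2, y1, y2). w1) (\<lambda>(w1, w2, y1, y2). y2) = 0 \<and>
     mi (joint m n N c) (\<lambda>(w1, w2, y1, y2). w2) (\<lambda>(w1, w2, y1, y2). y1) = 0"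

definition achievable :: "nat \<Rightarrow> nat \<Rightarrow> nat \<Rightarrow> real \<times> real \<Rightarrow> bool" where
  "achievable m n C R \<longleftrightarrow> fst R \<ge> 0 \<and> snd R \<ge> 0 \<and>
     (\<exists>code :: nat \<Rightarrow> zcode.
        (\<forall>N. link_ok C (code N) \<and>
             M1 (code N) = nat \<lceil>2 powr (real N * fst R)\<rceil> \<and>
             M2 (code N) = nat \<lceil>2 powr (real N * snd R)\<rceil> \<and>
             perfectly_secret m n N (code N)) \<and>
        (\<lambda>N. err_prob m n N (code N)) \<longlonglongrightarrow> 0)"

definition secrecy_capacity_region :: "nat \<Rightarrow> nat \<Rightarrow> nat \<Rightarrow> (real \<times> real) set" where
  "secrecy_capacity_region m n C = closure {R. achievable m n C R}"

end

theory Submission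
  imports Defs
begin

text \<open>Converse: fix the local randomness to values for which at least the average fraction of
  message pairs is decoded correctly. Given the output of receiver 1, the link sequence and the
  levels of \<open>x2\<close> that receiver 1 does not hear, one recovers \<open>W1\<close>, then \<open>x1\<close>, then the remaining
  levels of \<open>x2\<close>, then \<open>W2\<close>; counting gives the sum bound without any entropies and without
  secrecy.

  Achievability: the \<open>m - n\<close> levels of \<open>x2\<close> that receiver 1 does not hear and the \<open>m - n\<close> levels of
  \<open>x1\<close> that are free of interference carry data. On \<open>min C n\<close> of the interfering levels transmitter 2
  announces its next data bits over the link and transmitter 1 adds them to its own data, so that
  they cancel at receiver 1. The remaining interfering levels are time-shared; whenever user 2 uses
  one of them, transmitter 1 jams it with a uniform bit, a one-time pad against receiver 1.\<close>

subsection \<open>Mutual information of independent variables\<close>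

text \<open>Both sides are discrete measures on a countable type, so agreement on singletons
  suffices. This puts the product of marginals in the definition of mutual information into pmf
  form.\<close>

lemma pair_measure_pmf_countable:
  fixes A :: "'a::countable pmf" and B :: "'b::countable pmf"
  shows "measure_pmf A \<Otimes>\<^sub>M measure_pmf B = measure_pmf (pair_pmf A B)"
proof (rule measure_eqI_countable[of _ UNIV])
  have "sets (measure_pmf A \<Otimes>\<^sub>M measure_pmf B) =
    sets (count_space (UNIV::'a set) \<Otimes>\<^sub>M count_space (UNIV::'b set))"
    by (rule sets_pair_measure_cong) auto
  also have "\<dots> = sets (count_space UNIV)"
    by (subst pair_measure_countable) auto
  finally show "sets (measure_pmf A \<Otimes>\<^sub>M measure_pmf B) = Pow UNIV" by simp
  show "countable (UNIV :: ('a \<times> 'b) set)" by simp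
  fix z :: "'a \<times> 'b"
  obtain a b where z: "z = (a, b)" by force
  have "emeasure (measure_pmf A \<Otimes>\<^sub>M measure_pmf B) ({a} \<times> {b}) = emeasure A {a} * emeasure B {b}"
    by (rule measure_pmf.emeasure_pair_measure_Times) auto
  then show "emeasure (measure_pmf A \<Otimes>\<^sub>M measure_pmf B) {z} = emeasure (measure_pmf (pair_pmf A B)) {z}"
    by (simp add: z emeasure_pmf_single pmf_pair ennreal_mult)
qed auto

text \<open>Mutual information is the divergence of the joint law from the product of its marginals.
  The factors \<open>A\<close> and \<open>B\<close> are forced to be those marginals, so the
  divergence is that of a measure from itself.\<close>

lemma mi_eq_0_if_pair_pmf:
  fixes P :: "'a pmf" and X :: "'a \<Rightarrow> 'b::countable" and Y :: "'a \<Rightarrow> 'c::countable"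
  assumes "map_pmf (\<lambda>z. (X z, Y z)) P = pair_pmf A B"
  shows "mi P X Y = 0"
proof -
  have A: "map_pmf X P = A" and B: "map_pmf Y P = B"
    using arg_cong[OF assms, of "map_pmf fst"] arg_cong[OF assms, of "map_pmf snd"]
    by (simp_all add: pmf.map_comp o_def map_fst_pair_pmf map_snd_pair_pmf)
  have "distr (measure_pmf P) (count_space UNIV) X \<Otimes>\<^sub>M distr (measure_pmf P) (count_space UNIV) Y
      = measure_pmf (pair_pmf A B)"
    unfolding map_pmf_rep_eq[symmetric] A B by (rule pair_measure_pmf_countable)
  moreover have "distr (measure_pmf P) (count_space UNIV \<Otimes>\<^sub>M count_space UNIV) (\<lambda>z. (X z, Y z))
      = measure_pmf (pair_pmf A B)"
    unfolding pair_measure_countable[OF countableI_type countableI_type] UNIV_Times_UNIV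
      map_pmf_rep_eq[symmetric] assms ..
  ultimately show ?thesis
    unfolding mi_def prob_space.mutual_information_def[OF measure_pmf.prob_space_axioms]
    by (simp only: sigma_finite_measure.KL_same_eq_0[OF measure_pmf.sigma_finite_measure_axioms])
qed

subsection \<open>Converse\<close>

text \<open>Here \<open>qdim m n\<close> equals \<open>m\<close>: \<open>x1\<close> arrives
  unshifted and \<open>x2\<close> is pushed down by \<open>m - n\<close>, so its levels
  \<open>n..<m\<close> fall off the end at receiver 1.\<close>

lemma out_simps:
  assumes "n \<le> m"
  shows "out1 m n x1 x2 = map (\<lambda>j. x1 j \<noteq> (m - n \<le> j \<and> x2 (j - (m - n)))) [0..<m]"
    and "out2 m n x2 = map x2 [0..<m]"
  using assms by (auto simp: out1_def out2_def qdim_def dshift_def)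

section \<open>Counting decodable message pairs for fixed local randomness\<close>

context
  fixes m n N :: nat and c :: zcode
begin

definition link_seq :: "nat \<Rightarrow> nat \<Rightarrow> nat list" where
  "link_seq w2 u2 = map (link c w2 u2) [0..<N]"

definition sent1 :: "nat \<Rightarrow> nat \<Rightarrow> nat \<Rightarrow> nat \<Rightarrow> nat \<Rightarrow> nat \<Rightarrow> bool" where
  "sent1 w1 w2 u1 u2 t = enc1 c w1 (take t (link_seq w2 u2)) u1 t"

definition recv1 :: "nat \<Rightarrow> nat \<Rightarrow> nat \<Rightarrow> nat \<Rightarrow> bool list list" where
  "recv1 w1 w2 u1 u2 = map (\<lambda>t. out1 m n (sent1 w1 w2 u1 u2 t) (enc2 c w2 u2 t)) [0..<N]"

definition recv2 :: "nat \<Rightarrow> nat \<Rightarrow> bool list list" where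
  "recv2 w2 u2 = map (\<lambda>t. out2 m n (enc2 c w2 u2 t)) [0..<N]"

definition decodable :: "nat \<Rightarrow> nat \<Rightarrow> (nat \<times> nat) set" where
  "decodable u1 u2 = {(w1, w2). w1 < M1 c \<and> w2 < M2 c \<and>
     dec1 c (recv1 w1 w2 u1 u2) = w1 \<and> dec2 c (recv2 w2 u2) = w2}"

lemma joint_eq:
  "joint m n N c = do { w1 \<leftarrow> pmf_of_set {0..<M1 c}; w2 \<leftarrow> pmf_of_set {0..<M2 c};
     u1 \<leftarrow> rand1 c; u2 \<leftarrow> rand2 c;
     return_pmf (w1, w2, recv1 w1 w2 u1 u2, recv2 w2 u2) }"
  unfolding joint_def Let_def recv1_def recv2_def sent1_def link_seq_def ..

text \<open>Averaging: the success probability is the expectation, over the local randomness, of the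
  fraction of message pairs decoded correctly, so that fraction cannot stay below it
  everywhere.\<close>

lemma ex_decodable_card_ge:
  assumes "M1 c > 0" "M2 c > 0"
  shows "\<exists>u1 u2. (1 - err_prob m n N c) * (real (M1 c) * real (M2 c)) \<le> card (decodable u1 u2)"
proof (rule ccontr)
  assume neg: "\<not> ?thesis"
  define p where "p = 1 - err_prob m n N c"
  define K where "K = real (M1 c) * real (M2 c)"
  have K: "K > 0" using assms by (simp add: K_def)
  define G where "G = {(w1, w2, y1, y2). dec1 c y1 = w1 \<and> dec2 c y2 = w2}"
  define F where "F = (\<lambda>(u1, u2). map_pmf (\<lambda>(w1, w2). (w1, w2, recv1 w1 w2 u1 u2, recv2 w2 u2))
    (pair_pmf (pmf_of_set {0..<M1 c}) (pmf_of_set {0..<M2 c})))"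
  have pairs: "pair_pmf (pmf_of_set {0..<M1 c}) (pmf_of_set {0..<M2 c})
      = pmf_of_set ({0..<M1 c} \<times> {0..<M2 c})"
    using assms by (intro pmf_eqI) (auto simp: pmf_pair indicator_def split: if_splits)
  \<comment> \<open>The draws are independent, so they can be reordered with the local randomness
    first.\<close>
  have joint: "joint m n N c = bind_pmf (pair_pmf (rand1 c) (rand2 c)) F"
  proof -
    have "bind_pmf (pair_pmf (rand1 c) (rand2 c)) F =
       do { u1 \<leftarrow> rand1 c; u2 \<leftarrow> rand2 c; w1 \<leftarrow> pmf_of_set {0..<M1 c}; w2 \<leftarrow> pmf_of_set {0..<M2 c};
       return_pmf (w1, w2, recv1 w1 w2 u1 u2, recv2 w2 u2)}"
      by (simp add: F_def bind_pair_pmf map_pmf_def pair_pmf_def bind_assoc_pmf bind_return_pmf)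
    also have "\<dots> = do { u1 \<leftarrow> rand1 c; w1 \<leftarrow> pmf_of_set {0..<M1 c}; w2 \<leftarrow> pmf_of_set {0..<M2 c};
       u2 \<leftarrow> rand2 c; return_pmf (w1, w2, recv1 w1 w2 u1 u2, recv2 w2 u2)}"
      by (simp add: bind_commute_pmf[of "rand2 c"])
    also have "\<dots> = joint m n N c"
      unfolding joint_eq by (simp add: bind_commute_pmf[of "rand1 c"])
    finally show ?thesis ..
  qed
  have FG: "measure_pmf.prob (F (u1, u2)) G = card (decodable u1 u2) / K" for u1 u2
  proof -
    have "({0..<M1 c} \<times> {0..<M2 c}) \<inter> (\<lambda>(w1, w2). (w1, w2, recv1 w1 w2 u1 u2, recv2 w2 u2)) -` G
       = decodable u1 u2"
      by (auto simp: G_def decodable_def)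
    then show ?thesis
      using assms by (simp add: F_def pairs measure_pmf_of_set K_def)
  qed
  have less: "measure_pmf.prob (F u) G < p" for u
  proof -
    obtain u1 u2 where u: "u = (u1, u2)" by force
    have "real (card (decodable u1 u2)) < p * K"
      using neg by (auto simp: p_def K_def not_le)
    then show ?thesis unfolding u FG using K by (simp add: field_simps)
  qed
  have "p = measure_pmf.prob (joint m n N c) (UNIV - {(w1, w2, y1, y2). dec1 c y1 \<noteq> w1 \<or> dec2 c y2 \<noteq> w2})"
    using measure_pmf.prob_compl[of "{(w1, w2, y1, y2). dec1 c y1 \<noteq> w1 \<or> dec2 c y2 \<noteq> w2}"
      "joint m n N c"] by (simp add: p_def err_prob_def)
  also have "UNIV - {(w1, w2, y1, y2). dec1 c y1 \<noteq> w1 \<or> dec2 c y2 \<noteq> w2} = G"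
    by (auto simp: G_def)
  finally have p: "p = measure_pmf.prob (joint m n N c) G" .
  also have "\<dots> = measure_pmf.expectation (pair_pmf (rand1 c) (rand2 c)) (\<lambda>u. measure_pmf.prob (F u) G)"
    unfolding joint measure_pmf_bind
    by (subst measure_pmf.measure_bind[of _ _ "count_space UNIV"])
      (auto simp: space_subprob_algebra intro: prob_space_imp_subprob_space measure_pmf.prob_space_axioms)
  also have "\<dots> < p"
  proof -
    have "integrable (pair_pmf (rand1 c) (rand2 c)) (\<lambda>u. measure_pmf.prob (F u) G)"
      by (rule measure_pmf.integrable_const_bound[where B = 1]) auto
    then show ?thesis
      using measure_pmf.expectation_less[of "pair_pmf (rand1 c) (rand2 c)"  "\<lambda>u. measure_pmf.prob (F u) G" p] less
      by auto
  qed
  finally show False by simp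
qed

text \<open>Three injections on the decodable pairs. The first spends \<open>m + C + (m - n)\<close>
  bits per channel use. Each of the other two keeps one message and replaces the other by the output
  it is decoded from.\<close>

lemma card_decodable_le:
  assumes "n \<le> m" "link_ok C c"
  shows "card (decodable u1 u2) \<le> 2 ^ ((2 * m - n + C) * N)"
    and "card (decodable u1 u2) \<le> 2 ^ (m * N) * M2 c"
    and "card (decodable u1 u2) \<le> M1 c * 2 ^ (m * N)"
proof -
  define L :: "nat \<Rightarrow> bool list list set"
    where "L k = {xs. set xs \<subseteq> {ys. length ys = k} \<and> length xs = N}" for k
  define V where "V = {xs. set xs \<subseteq> {0..<2 ^ C :: nat} \<and> length xs = N}"
  have vecs: "finite {ys :: bool list. length ys = k}" "card {ys :: bool list. length ys = k} = 2 ^ k" for k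
    using finite_lists_length_eq[of "UNIV :: bool set" k] card_lists_length_eq[of "UNIV :: bool set" k]
    by simp_all
  have fin: "finite (L k)" for k
    unfolding L_def by (intro finite_lists_length_eq vecs)
  have finV: "finite V"
    unfolding V_def by (intro finite_lists_length_eq) auto
  have cardL: "card (L k) = 2 ^ (k * N)" for k
    unfolding L_def by (simp add: card_lists_length_eq vecs power_mult)
  have cardV: "card V = 2 ^ (C * N)"
    unfolding V_def by (subst card_lists_length_eq) (auto simp: power_mult)
  define low where "low w2 = map (\<lambda>t. map (enc2 c w2 u2 t) [n..<m]) [0..<N]" for w2
  have r1: "recv1 w1 w2 u1 u2 \<in> L m" for w1 w2
    by (auto simp: L_def recv1_def out_simps[OF assms(1)])
  have r2: "recv2 w2 u2 \<in> L m" for w2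
    by (auto simp: L_def recv2_def out_simps[OF assms(1)])
  have lw: "low w2 \<in> L (m - n)" for w2
    by (auto simp: L_def low_def)
  have lk: "link_seq w2 u2 \<in> V" for w2
    using assms(2) by (auto simp: V_def link_seq_def link_ok_def)
  have "inj_on (\<lambda>(w1, w2). (recv1 w1 w2 u1 u2, link_seq w2 u2, low w2)) (decodable u1 u2)"
  proof (rule inj_onI, clarify)
    fix w1 w2 w1' w2'
    assume d: "(w1, w2) \<in> decodable u1 u2" "(w1', w2') \<in> decodable u1 u2"
      and eq: "recv1 w1 w2 u1 u2 = recv1 w1' w2' u1 u2" "link_seq w2 u2 = link_seq w2' u2"
        "low w2 = low w2'"
    have w1: "w1 = w1'" using d eq(1) unfolding decodable_def by clarsimp
    have "enc2 c w2 u2 t j = enc2 c w2' u2 t j" if t: "t < N" and j: "j < m" for t j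
    \<comment> \<open>For \<open>j < n\<close> the bit reaches receiver 1 at level
      \<open>j + (m - n)\<close>, added to a bit of \<open>x1\<close> that both pairs share because
      \<open>W1\<close> and the link sequence agree. The other levels are recorded in
      \<open>low\<close>.\<close>
    proof (cases "j < n")
      case True
      have "sent1 w1 w2 u1 u2 t = sent1 w1' w2' u1 u2 t"
        by (simp add: sent1_def eq w1)
      moreover have "out1 m n (sent1 w1 w2 u1 u2 t) (enc2 c w2 u2 t) =
          out1 m n (sent1 w1' w2' u1 u2 t) (enc2 c w2' u2 t)"
        using eq(1) t by (simp add: recv1_def)
      moreover have "j + (m - n) < m" using True assms(1) by simp
      ultimately have "(sent1 w1 w2 u1 u2 t (j + (m - n)) \<noteq> enc2 c w2 u2 t j) =
          (sent1 w1 w2 u1 u2 t (j + (m - n)) \<noteq> enc2 c w2' u2 t j)"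
        by (auto simp: out_simps[OF assms(1)] dest!: bspec[of _ _ "j + (m - n)"])
      then show ?thesis by auto
    next
      case False
      then show ?thesis using eq(3) t j by (auto simp: low_def)
    qed
    then have "recv2 w2 u2 = recv2 w2' u2"
      by (auto simp: recv2_def out_simps[OF assms(1)])
    then show "w1 = w1' \<and> w2 = w2'" using d w1 unfolding decodable_def by (clarsimp; metis)
  qed
  then have "card (decodable u1 u2) \<le> card (L m \<times> V \<times> L (m - n))"
    by (rule card_inj_on_le) (use r1 lk lw in \<open>auto simp: fin finV\<close>)
  also have "\<dots> = 2 ^ ((2 * m - n + C) * N)"
  proof -
    have eq: "2 * m - n + C = m + (C + (m - n))" using assms(1) by simp
    show ?thesis
      unfolding eq card_cartesian_product cardL cardV distrib_right power_add ..
  qed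
  finally show "card (decodable u1 u2) \<le> 2 ^ ((2 * m - n + C) * N)" .
  have "inj_on (\<lambda>(w1, w2). (recv1 w1 w2 u1 u2, w2)) (decodable u1 u2)"
    by (rule inj_on_inverseI[where g = "\<lambda>(y1, w2). (dec1 c y1, w2)"]) (auto simp: decodable_def)
  then have "card (decodable u1 u2) \<le> card (L m \<times> {..<M2 c})"
    by (rule card_inj_on_le) (use r1 in \<open>auto simp: fin decodable_def\<close>)
  then show "card (decodable u1 u2) \<le> 2 ^ (m * N) * M2 c"
    by (simp add: card_cartesian_product cardL)
  have "inj_on (\<lambda>(w1, w2). (w1, recv2 w2 u2)) (decodable u1 u2)"
    by (rule inj_on_inverseI[where g = "\<lambda>(w1, y2). (w1, dec2 c y2)"]) (auto simp: decodable_def)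
  then have "card (decodable u1 u2) \<le> card ({..<M1 c} \<times> L m)"
    by (rule card_inj_on_le) (use r2 in \<open>auto simp: fin decodable_def\<close>)
  then show "card (decodable u1 u2) \<le> M1 c * 2 ^ (m * N)"
    by (simp add: card_cartesian_product cardL)
qed

end

section \<open>From counting bounds to rate bounds\<close>

text \<open>If \<open>r > k\<close>, the quotient of the two powers grows beyond 2 and beats the
  constant factor 1/2.\<close>

lemma rate_le_if_eventually:
  fixes r k :: real
  assumes "eventually (\<lambda>N. (1/2) * 2 powr (real N * r) \<le> 2 powr (real N * k)) sequentially"
  shows "r \<le> k"
proof (rule ccontr)
  assume "\<not> r \<le> k"
  then have "filterlim (\<lambda>N. real N * (r - k)) at_top sequentially"
    by (intro filterlim_at_top_mult_tendsto_pos[OF tendsto_const] filterlim_real_sequentially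
        | simp add: mult.commute[of "real _"])+
  then have "eventually (\<lambda>N. real N * (r - k) > 1) sequentially"
    by (simp add: filterlim_at_top_dense)
  with assms have "eventually (\<lambda>N::nat. False) sequentially"
  proof eventually_elim
    case (elim N)
    have "2 powr (real N * r) = 2 powr (real N * k) * 2 powr (real N * (r - k))"
      by (simp add: powr_add[symmetric] algebra_simps)
    moreover have "2 powr (real N * (r - k)) > 2 powr 1"
      using elim by (intro powr_less_mono) auto
    ultimately show ?case using elim(1) by simp
  qed
  then show False by simp
qed

text \<open>Once the error is below 1/2, some fixed local randomness decodes at least half of all
  message pairs, and the counting bounds apply. For the single-rate bounds the size of the other
  message set cancels.\<close>

lemma achievable_imp_bounds:
  assumes "n \<le> m" "achievable m n C (R1, R2)"
  shows "0 \<le> R1" "0 \<le> R2" "R1 \<le> real m" "R2 \<le> real m" "R1 + R2 \<le> 2 * real m - real n + real C"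
proof -
  obtain code where code: "\<And>N. link_ok C (code N)"
      "\<And>N. M1 (code N) = nat \<lceil>2 powr (real N * R1)\<rceil>" "\<And>N. M2 (code N) = nat \<lceil>2 powr (real N * R2)\<rceil>"
    and err: "(\<lambda>N. err_prob m n N (code N)) \<longlonglongrightarrow> 0"
    using assms(2) by (auto simp: achievable_def)
  show "0 \<le> R1" "0 \<le> R2"
    using assms(2) by (auto simp: achievable_def)
  have M: "2 powr (real N * R1) \<le> M1 (code N)" "2 powr (real N * R2) \<le> M2 (code N)" for N
    unfolding code by (rule of_nat_ceiling)+
  have ev: "eventually (\<lambda>N. \<exists>u1 u2. (1/2) * (real (M1 (code N)) * real (M2 (code N)))
      \<le> card (decodable m n N (code N) u1 u2)) sequentially"
  proof -
    have "eventually (\<lambda>N. err_prob m n N (code N) < 1/2) sequentially"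
      using err by (rule order_tendstoD) simp
    then show ?thesis
    proof eventually_elim
      case (elim N)
      have pos: "M1 (code N) > 0" "M2 (code N) > 0"
        using M[of N] by (auto intro!: Nat.gr0I simp: powr_le_iff)
      have "(1/2) * (real (M1 (code N)) * real (M2 (code N)))
         \<le> (1 - err_prob m n N (code N)) * (real (M1 (code N)) * real (M2 (code N)))"
        using elim by (intro mult_right_mono) auto
      with ex_decodable_card_ge[OF pos, of m n N] show ?case
        by (meson order_trans)
    qed
  qed
  have powr_eq: "real (2 ^ (k * N)) = 2 powr (real N * real k)" for k N :: nat
    by (simp add: powr_realpow[symmetric] mult.commute)
  have "real (2 * m - n + C) = 2 * real m - real n + real C"
    using assms(1) by simp
  moreover have "R1 + R2 \<le> real (2 * m - n + C)"
  proof (rule rate_le_if_eventually, use ev in eventually_elim)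
    case (elim N)
    then obtain u1 u2 where u: "(1/2) * (real (M1 (code N)) * real (M2 (code N)))
      \<le> card (decodable m n N (code N) u1 u2)" by blast
    have "(1/2) * 2 powr (real N * (R1 + R2)) = (1/2) * (2 powr (real N * R1) * 2 powr (real N * R2))"
      by (simp add: powr_add distrib_left)
    also have "\<dots> \<le> (1/2) * (real (M1 (code N)) * real (M2 (code N)))"
      using M by (intro mult_left_mono mult_mono) auto
    also note u
    also have "real (card (decodable m n N (code N) u1 u2)) \<le> real (2 ^ ((2 * m - n + C) * N))"
      using card_decodable_le(1)[OF assms(1) code(1)] of_nat_le_iff by blast
    finally show ?case unfolding powr_eq .
  qed
  ultimately show "R1 + R2 \<le> 2 * real m - real n + real C" by simp
  show "R1 \<le> real m"
  proof (rule rate_le_if_eventually, use ev in eventually_elim)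
    case (elim N)
    then obtain u1 u2 where u: "(1/2) * (real (M1 (code N)) * real (M2 (code N)))
      \<le> card (decodable m n N (code N) u1 u2)" by blast
    also have "real (card (decodable m n N (code N) u1 u2)) \<le> real (2 ^ (m * N) * M2 (code N))"
      using card_decodable_le(2)[OF assms(1) code(1)] of_nat_le_iff by blast
    also have "\<dots> = 2 powr (real N * real m) * real (M2 (code N))"
      by (simp add: powr_eq[symmetric])
    finally have "((1/2) * real (M1 (code N))) * real (M2 (code N))
        \<le> 2 powr (real N * real m) * real (M2 (code N))"
      by (simp add: mult_ac)
    moreover have "real (M2 (code N)) > 0"
      using M(2)[of N] by (rule less_le_trans[rotated]) simp
    ultimately have "(1/2) * real (M1 (code N)) \<le> 2 powr (real N * real m)"
      by (rule mult_right_le_imp_le)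
    with M(1)[of N] show ?case by simp
  qed
  show "R2 \<le> real m"
  proof (rule rate_le_if_eventually, use ev in eventually_elim)
    case (elim N)
    then obtain u1 u2 where u: "(1/2) * (real (M1 (code N)) * real (M2 (code N)))
      \<le> card (decodable m n N (code N) u1 u2)" by blast
    also have "real (card (decodable m n N (code N) u1 u2)) \<le> real (M1 (code N) * 2 ^ (m * N))"
      using card_decodable_le(3)[OF assms(1) code(1)] of_nat_le_iff by blast
    also have "\<dots> = 2 powr (real N * real m) * real (M1 (code N))"
      by (simp add: powr_eq[symmetric])
    finally have "((1/2) * real (M2 (code N))) * real (M1 (code N))
        \<le> 2 powr (real N * real m) * real (M1 (code N))"
      by (simp add: mult_ac)
    moreover have "real (M1 (code N)) > 0"
      using M(1)[of N] by (rule less_le_trans[rotated]) simp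
    ultimately have "(1/2) * real (M2 (code N)) \<le> 2 powr (real N * real m)"
      by (rule mult_right_le_imp_le)
    with M(2)[of N] show ?case by simp
  qed
qed

subsection \<open>Achievability\<close>

text \<open>\<open>S1\<close> and \<open>S2\<close> are the (time, level) slots carrying data of user 1 and user 2. Transmitter 1
  fills its remaining slots \<open>B\<close> with uniform jamming bits. A slot of \<open>S2\<close> that collides with one of
  \<open>S1\<close> at receiver 1 is announced over the link one time step ahead and cancelled.\<close>
locale cancel_scheme =
  fixes m n c C N K1 K2 :: nat and S1 S2 B :: "(nat \<times> nat) set"
    and f1 f2 g :: "nat \<Rightarrow> (nat \<times> nat) set" and h :: "nat set \<Rightarrow> nat"
  assumes nm: "n \<le> m" and K1: "K1 > 0" and K2: "K2 > 0"
    and S2: "S2 \<subseteq> {..<N} \<times> {..<m}"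
    and B: "B = {..<N} \<times> {..<m} - S1"
    and f1: "f1 w \<subseteq> S1" and f2: "f2 w \<subseteq> S2"
    and clash: "(t, j) \<in> S2 \<Longrightarrow> j < n \<Longrightarrow> (t, j + (m - n)) \<in> S1 \<Longrightarrow> 0 < t \<and> j < c"
    and g: "bij_betw g {0..<2 ^ card B} (Pow B)"
    and h: "inj_on h (Pow {..<c})" "h ` Pow {..<c} \<subseteq> {0..<2 ^ C}"
    and S1: "S1 \<subseteq> {..<N} \<times> {..<m}"
begin

definition top_bits :: "nat \<Rightarrow> nat \<Rightarrow> nat set" where
  "top_bits w t = {j. j < c \<and> (t, j) \<in> f2 w}"

definition levels :: "(nat \<times> nat) set \<Rightarrow> bool list list" where
  "levels Y = map (\<lambda>t. map (\<lambda>j. (t, j) \<in> Y) [0..<m]) [0..<N]"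

definition slots :: "bool list list \<Rightarrow> (nat \<times> nat) set" where
  "slots y = {(t, j). t < N \<and> j < m \<and> y ! t ! j}"

text \<open>The link message of time \<open>t\<close> announces bits of time \<open>Suc t\<close>,
  so at time \<open>t\<close> transmitter 1 finds what it has to cancel in entry
  \<open>t - 1\<close>. Its seed \<open>u\<close> selects through \<open>g\<close> the set of
  jamming slots that carry a one; transmitter 2 is deterministic.\<close>

definition code :: zcode where
  "code = \<lparr>M1 = K1, M2 = K2, rand1 = pmf_of_set {0..<2 ^ card B}, rand2 = return_pmf 0,
     enc2 = (\<lambda>w u t j. (t, j) \<in> f2 w),
     link = (\<lambda>w u t. h (top_bits w (Suc t))),
     enc1 = (\<lambda>w v u t j. if (t, j) \<in> S1
        then ((t, j) \<in> f1 w) \<noteq>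
          (0 < t \<and> m - n \<le> j \<and> j - (m - n) \<in> inv_into (Pow {..<c}) h (v ! (t - 1)))
        else (t, j) \<in> g u),
     dec1 = (\<lambda>y. inv_into {0..<K1} f1 (slots y \<inter> S1)),
     dec2 = (\<lambda>y. inv_into {0..<K2} f2 (slots y \<inter> S2))\<rparr>"

text \<open>What receiver 1 sees of user 2 after cancellation: only bits landing on jamming slots,
  shifted down by \<open>m - n\<close>.\<close>

definition interference :: "nat \<Rightarrow> (nat \<times> nat) set" where
  "interference w = {(t, j) \<in> B. m - n \<le> j \<and> (t, j - (m - n)) \<in> f2 w}"

lemma top_bits_subset: "top_bits w t \<in> Pow {..<c}"
  by (auto simp: top_bits_def)

lemma code_sel:
  "M1 code = K1" "M2 code = K2" "rand1 code = pmf_of_set {0..<2 ^ card B}"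
  "rand2 code = return_pmf 0" "enc2 code w u t j \<longleftrightarrow> (t, j) \<in> f2 w"
  "link code w u t = h (top_bits w (Suc t))"
  "enc1 code w v u t j = (if (t, j) \<in> S1
     then ((t, j) \<in> f1 w) \<noteq>
       (0 < t \<and> m - n \<le> j \<and> j - (m - n) \<in> inv_into (Pow {..<c}) h (v ! (t - 1)))
     else (t, j) \<in> g u)"
  "dec1 code y = inv_into {0..<K1} f1 (slots y \<inter> S1)"
  "dec2 code y = inv_into {0..<K2} f2 (slots y \<inter> S2)"
  by (simp_all add: code_def)

lemma link_ok_code: "link_ok C code"
proof -
  have "h (top_bits w t) \<in> {0..<2 ^ C}" for w t
    using h(2) top_bits_subset by (rule subsetD[OF _ imageI])
  then show ?thesis unfolding link_ok_def code_sel by simp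
qed

lemma slots_levels: "slots (levels Y) = Y \<inter> {..<N} \<times> {..<m}"
  by (auto simp: slots_def levels_def)

lemma recv2_code: "recv2 m n N code w2 u2 = levels (f2 w2)"
  by (simp add: recv2_def out_simps[OF nm] levels_def code_sel)

text \<open>On \<open>S1\<close> every colliding bit of user 2 was announced, by
  \<open>clash\<close>, and is added twice, hence vanishes. On \<open>B\<close> it is added to a
  jamming bit, which gives the symmetric difference.\<close>

lemma recv1_code:
  assumes "u1 < 2 ^ card B"
  shows "recv1 m n N code w1 w2 u1 u2 = levels (f1 w1 \<union> sym_diff (g u1) (interference w2))"
proof -
  have gB: "g u1 \<subseteq> B"
    using bij_betwE[OF g] assms by simp
  have "(sent1 N code w1 w2 u1 u2 t j \<noteq> (m - n \<le> j \<and> (t, j - (m - n)) \<in> f2 w2)) =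
      ((t, j) \<in> f1 w1 \<union> sym_diff (g u1) (interference w2))" (is "?l = ?r")
    if t: "t < N" and j: "j < m" for t j
  proof (cases "(t, j) \<in> S1")
    case True
    have announced: "0 < t \<and> j - (m - n) < c" if "m - n \<le> j" "(t, j - (m - n)) \<in> f2 w2"
    proof (rule clash)
      show "(t, j - (m - n)) \<in> S2" using f2 that by blast
      show "j - (m - n) < n" using that(1) j nm by linarith
      show "(t, j - (m - n) + (m - n)) \<in> S1" using True that(1) by simp
    qed
    \<comment> \<open>For \<open>t > 0\<close> the decoded link entry is
      \<open>top_bits w2 t\<close>. At \<open>t = 0\<close> no link message has arrived, and
      \<open>announced\<close> excludes a collision then, so both sides are false.\<close>
    have cancelled: "0 < t \<and> m - n \<le> j \<and> j - (m - n) \<in> inv_into (Pow {..<c}) h (take t (link_seq N code w2 u2) ! (t - 1))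
      \<longleftrightarrow> m - n \<le> j \<and> (t, j - (m - n)) \<in> f2 w2"
    proof (cases "0 < t")
      case t0: True
      then have "take t (link_seq N code w2 u2) ! (t - 1) = h (top_bits w2 t)"
        using t by (simp add: link_seq_def code_sel)
      then have inv: "inv_into (Pow {..<c}) h (take t (link_seq N code w2 u2) ! (t - 1)) = top_bits w2 t"
        using inv_into_f_f[OF h(1) top_bits_subset] by simp
      show ?thesis
        unfolding inv using t0 announced by (auto simp: top_bits_def)
    next
      case False
      then show ?thesis using announced by auto
    qed
    have "sent1 N code w1 w2 u1 u2 t j =
        (((t, j) \<in> f1 w1) \<noteq> (m - n \<le> j \<and> (t, j - (m - n)) \<in> f2 w2))"
      unfolding sent1_def code_sel if_P[OF True] cancelled ..
    moreover have "?r = ((t, j) \<in> f1 w1)"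
      using True gB unfolding interference_def by (auto simp: B)
    ultimately show ?thesis by auto
  next
    case False
    then have "sent1 N code w1 w2 u1 u2 t j = ((t, j) \<in> g u1)"
      by (simp add: sent1_def code_sel)
    moreover have "(t, j) \<in> interference w2 \<longleftrightarrow> m - n \<le> j \<and> (t, j - (m - n)) \<in> f2 w2"
      using False t j unfolding interference_def by (auto simp: B)
    moreover have "(t, j) \<notin> f1 w1" using False f1 by auto
    ultimately show ?thesis by auto
  qed
  then show ?thesis
    by (simp add: recv1_def out_simps[OF nm] levels_def code_sel)
qed

text \<open>The one-time pad: toggling by a fixed subset of \<open>B\<close> is an involution of
  \<open>Pow B\<close>, so the padded interference is uniform whatever \<open>w2\<close> is.\<close>

lemma joint_code:
  "joint m n N code = do { w1 \<leftarrow> pmf_of_set {0..<K1}; w2 \<leftarrow> pmf_of_set {0..<K2};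
     Y \<leftarrow> pmf_of_set (Pow B); return_pmf (w1, w2, levels (f1 w1 \<union> Y), levels (f2 w2)) }"
proof -
  have pad: "map_pmf (\<lambda>u. sym_diff (g u) (interference w)) (pmf_of_set {0..<2 ^ card B}) = pmf_of_set (Pow B)"
    for w
  proof -
    have "bij_betw (\<lambda>X. sym_diff X (interference w)) (Pow B) (Pow B)"
      by (rule bij_betwI[where g = "\<lambda>X. sym_diff X (interference w)"])
         (auto simp: interference_def)
    from bij_betw_trans[OF g this] show ?thesis
      by (intro map_pmf_of_set_bij_betw) (auto simp: o_def)
  qed
  have "joint m n N code = do { w1 \<leftarrow> pmf_of_set {0..<K1}; w2 \<leftarrow> pmf_of_set {0..<K2};
     u1 \<leftarrow> pmf_of_set {0..<2 ^ card B};
     return_pmf (w1, w2, recv1 m n N code w1 w2 u1 0, levels (f2 w2)) }"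
    unfolding joint_eq recv2_code code_sel bind_return_pmf ..
  also have "\<dots> = do { w1 \<leftarrow> pmf_of_set {0..<K1}; w2 \<leftarrow> pmf_of_set {0..<K2};
     u1 \<leftarrow> pmf_of_set {0..<2 ^ card B};
     return_pmf (w1, w2, levels (f1 w1 \<union> sym_diff (g u1) (interference w2)), levels (f2 w2)) }"
    by (intro bind_pmf_cong[OF refl]) (simp add: recv1_code)
  also have "\<dots> = do { w1 \<leftarrow> pmf_of_set {0..<K1}; w2 \<leftarrow> pmf_of_set {0..<K2};
     Y \<leftarrow> map_pmf (\<lambda>u. sym_diff (g u) (interference w2)) (pmf_of_set {0..<2 ^ card B});
     return_pmf (w1, w2, levels (f1 w1 \<union> Y), levels (f2 w2)) }"
    unfolding bind_map_pmf ..
  finally show ?thesis unfolding pad .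
qed

text \<open>By \<open>joint_code\<close>, the second output is a function of \<open>w2\<close>
  alone, and the first is a function of \<open>w1\<close> and a pad drawn independently of
  \<open>w2\<close>.\<close>

lemma perfectly_secret_code: "perfectly_secret m n N code"
  unfolding perfectly_secret_def
proof
  let ?P1 = "pmf_of_set {0..<K1}" and ?P2 = "pmf_of_set {0..<K2}" and ?PB = "pmf_of_set (Pow B)"
  have "map_pmf (\<lambda>z. ((\<lambda>(w1, w2, y1, y2). w1) z, (\<lambda>(w1, w2, y1, y2). y2) z)) (joint m n N code)
      = pair_pmf ?P1 (map_pmf (\<lambda>w2. levels (f2 w2)) ?P2)"
    unfolding joint_code pair_pmf_def by (simp add: map_bind_pmf bind_map_pmf)
  then show "mi (joint m n N code) (\<lambda>(w1, w2, y1, y2). w1) (\<lambda>(w1, w2, y1, y2). y2) = 0"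
    by (rule mi_eq_0_if_pair_pmf)
  have "map_pmf (\<lambda>z. ((\<lambda>(w1, w2, y1, y2). w2) z, (\<lambda>(w1, w2, y1, y2). y1) z)) (joint m n N code)
      = pair_pmf ?P2 (do {w1 \<leftarrow> ?P1; Y \<leftarrow> ?PB; return_pmf (levels (f1 w1 \<union> Y))})"
    unfolding joint_code pair_pmf_def
    by (subst bind_commute_pmf[of ?P1 ?P2]) (simp add: map_bind_pmf bind_assoc_pmf bind_return_pmf)
  then show "mi (joint m n N code) (\<lambda>(w1, w2, y1, y2). w2) (\<lambda>(w1, w2, y1, y2). y1) = 0"
    by (rule mi_eq_0_if_pair_pmf)
qed

text \<open>The pad lives on \<open>B\<close>, disjoint from \<open>S1\<close>, so restricting the
  first output to \<open>S1\<close> returns \<open>f1 w1\<close> exactly.\<close>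

lemma err_prob_code:
  assumes "inj_on f1 {0..<K1}" "inj_on f2 {0..<K2}"
  shows "err_prob m n N code = 0"
proof -
  have fin: "finite (Pow B)" "Pow B \<noteq> {}" by (auto simp: B)
  have "dec1 code y1 = w1 \<and> dec2 code y2 = w2" if "(w1, w2, y1, y2) \<in> set_pmf (joint m n N code)"
    for w1 w2 y1 y2
  proof -
    from that obtain Y where w: "w1 < K1" "w2 < K2" and Y: "Y \<subseteq> B"
      and y: "y1 = levels (f1 w1 \<union> Y)" "y2 = levels (f2 w2)"
      using K1 K2 fin by (auto simp: joint_code)
    have "slots y1 \<inter> S1 = f1 w1" "slots y2 \<inter> S2 = f2 w2"
      using S1 S2 f1[of w1] f2[of w2] Y by (auto simp: y slots_levels B)
    then show ?thesis
      using w assms by (simp add: code_sel inv_into_f_f)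
  qed
  then show ?thesis
    unfolding err_prob_def by (subst measure_pmf_zero_iff) auto
qed

end

section \<open>Slot allocation and time sharing\<close>

text \<open>Only error-freeness depends on the messages fitting into the slots.
  \<open>achievable\<close> demands a secret code with prescribed message sizes at every block
  length, including short ones where they do not fit.\<close>

lemma ex_slot_code:
  fixes m n C N K1 K2 :: nat and S1 S2 :: "(nat \<times> nat) set"
  assumes nm: "n \<le> m" and K: "K1 > 0" "K2 > 0"
    and S: "S1 \<subseteq> {..<N} \<times> {..<m}" "S2 \<subseteq> {..<N} \<times> {..<m}"
    and clash: "\<And>t j. (t, j) \<in> S2 \<Longrightarrow> j < n \<Longrightarrow> (t, j + (m - n)) \<in> S1 \<Longrightarrow> 0 < t \<and> j < min C n"
  shows "\<exists>c. link_ok C c \<and> M1 c = K1 \<and> M2 c = K2 \<and> perfectly_secret m n N c \<and>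
    (K1 \<le> 2 ^ card S1 \<longrightarrow> K2 \<le> 2 ^ card S2 \<longrightarrow> err_prob m n N c = 0)"
proof -
  have ex_f: "\<exists>f. (\<forall>w. f w \<subseteq> S) \<and> (K \<le> 2 ^ card S \<longrightarrow> inj_on f {0..<K})"
    if "finite S" for S :: "(nat \<times> nat) set" and K :: nat
  proof (cases "K \<le> 2 ^ card S")
    case True
    then obtain f where "f ` {0..<K} \<subseteq> Pow S" "inj_on f {0..<K}"
      using card_le_inj[of "{0..<K}" "Pow S"] \<open>finite S\<close> by (auto simp: card_Pow)
    then show ?thesis
      \<comment> \<open>The default \<open>{}\<close> beyond \<open>K\<close> keeps
        \<open>f w\<close> inside \<open>S\<close> for every \<open>w\<close>.\<close>
      by (intro exI[of _ "\<lambda>w. if w < K then f w else {}"])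
        (auto simp: inj_on_def image_subset_iff Pow_def dest!: bspec)
  qed auto
  have fin: "finite S1" "finite S2" using S finite_subset by blast+
  obtain f1 where inj1: "\<And>w. f1 w \<subseteq> S1" "K1 \<le> 2 ^ card S1 \<Longrightarrow> inj_on f1 {0..<K1}"
    using ex_f[OF fin(1), of K1] by blast
  obtain f2 where inj2: "\<And>w. f2 w \<subseteq> S2" "K2 \<le> 2 ^ card S2 \<Longrightarrow> inj_on f2 {0..<K2}"
    using ex_f[OF fin(2), of K2] by blast
  define B where "B = {..<N} \<times> {..<m} - S1"
  have "finite B" by (simp add: B_def)
  then obtain g :: "nat \<Rightarrow> (nat \<times> nat) set" where g: "bij_betw g {0..<2 ^ card B} (Pow B)"
    using ex_bij_betw_nat_finite[of "Pow B"] by (auto simp: card_Pow)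
  obtain h where h: "inj_on h (Pow {..<min C n})" "h ` Pow {..<min C n} \<subseteq> {0..<2 ^ C :: nat}"
    using card_le_inj[of "Pow {..<min C n}" "{0..<2 ^ C :: nat}"] by (auto simp: card_Pow)
  interpret cancel_scheme m n "min C n" C N K1 K2 S1 S2 B f1 f2 g h
    by unfold_locales (use nm K S clash inj1 inj2 g h B_def in auto)
  show ?thesis
    using link_ok_code perfectly_secret_code err_prob_code inj1(2) inj2(2)
    by (intro exI[of _ code]) (auto simp: code_sel)
qed

text \<open>Time 0 carries no data, since nothing can be announced for it. The \<open>n - c\<close>
  contested levels belong to user 1 during the first \<open>T\<close> later steps and to user 2
  during the remaining \<open>N - 1 - T\<close>.\<close>

lemma ex_time_sharing_code:
  fixes m n C N T K1 K2 :: nat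
  assumes nm: "n \<le> m" and K: "K1 > 0" "K2 > 0" and T: "T \<le> N - 1"
  defines "c \<equiv> min C n"
  shows "\<exists>co. link_ok C co \<and> M1 co = K1 \<and> M2 co = K2 \<and> perfectly_secret m n N co \<and>
    (K1 \<le> 2 ^ ((N - 1) * (m - n + c) + T * (n - c)) \<longrightarrow>
     K2 \<le> 2 ^ ((N - 1) * (m - n + c) + (N - 1 - T) * (n - c)) \<longrightarrow> err_prob m n N co = 0)"
proof -
  \<comment> \<open>Levels \<open>{m - n + c..<m}\<close> of user 1 are exactly where levels
    \<open>{c..<n}\<close> of user 2 arrive at receiver 1.\<close>
  define S1 where "S1 = {1..<N} \<times> {..<m - n + c} \<union> {1..<Suc T} \<times> {m - n + c..<m}"
  define S2 where "S2 = {1..<N} \<times> ({..<c} \<union> {n..<m}) \<union> {Suc T..<N} \<times> {c..<n}"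
  have c: "c \<le> n" by (simp add: c_def)
  have "card S1 = (N - 1) * (m - n + c) + T * (n - c)"
    unfolding S1_def using nm c by (subst card_Un_disjoint) (auto simp: card_cartesian_product)
  moreover have "card ({..<c} \<union> {n..<m}) = m - n + c"
    using c by (subst card_Un_disjoint) auto
  then have "card S2 = (N - 1) * (m - n + c) + (N - 1 - T) * (n - c)"
    unfolding S2_def using nm c by (subst card_Un_disjoint) (auto simp: card_cartesian_product)
  moreover have "S1 \<subseteq> {..<N} \<times> {..<m}" "S2 \<subseteq> {..<N} \<times> {..<m}"
    using T nm c by (auto simp: S1_def S2_def)
  moreover have "0 < t \<and> j < min C n" if "(t, j) \<in> S2" "j < n" "(t, j + (m - n)) \<in> S1" for t j
    using that nm c unfolding c_def[symmetric] by (auto simp: S1_def S2_def)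
  ultimately show ?thesis
    using ex_slot_code[OF nm K, of S1 N S2 C] by simp
qed

text \<open>User 1 gets a fraction \<open>s\<close> of the time on the contested levels. The margin
  \<open>e\<close> absorbs the idle step and the rounding of \<open>s * (N - 1)\<close>.\<close>

lemma shrunk_pair_achievable:
  fixes m n C :: nat
  assumes nm: "n \<le> m" and R: "R1 \<le> real m" "R2 \<le> real m" "R1 + R2 \<le> 2 * real m - real n + real C"
    and e: "e > 0"
  shows "achievable m n C (max 0 (R1 - e), max 0 (R2 - e))"
proof -
  define c where "c = min C n"
  define a d where "a = real (m - n + c)" and "d = real (n - c)"
  have c: "c \<le> n" by (simp add: c_def)
  have ad: "a + d = real m" "0 \<le> a" "0 \<le> d" using nm c by (auto simp: a_def d_def)
  \<comment> \<open>If \<open>C\<close> is at least \<open>n\<close> then \<open>a\<close> equals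
    \<open>m\<close>, and the single-rate bounds give this.\<close>
  have sum: "R1 + R2 \<le> a + real m"
    using R nm by (auto simp: a_def c_def min_def split: if_splits)
  obtain s where s: "0 \<le> s" "s \<le> 1" "R1 \<le> a + s * d" "R2 \<le> a + (1 - s) * d"
  proof (cases "R1 \<le> a")
    case True
    then show thesis using R ad by (intro that[of 0]) auto
  next
    case False
    then have "d > 0" using R ad by linarith
    \<comment> \<open>User 1 gets exactly the share it needs; by \<open>sum\<close>, the rest
      suffices for user 2.\<close>
    define s where "s = (R1 - a) / d"
    have sd: "s * d = R1 - a" "(1 - s) * d = d - s * d"
      using \<open>d > 0\<close> by (simp_all add: s_def left_diff_distrib[of 1])
    have "0 \<le> s" "s \<le> 1"
      using \<open>d > 0\<close> False R ad by (simp_all add: s_def divide_le_eq)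
    then show thesis
      by (rule that) (use sd ad sum in linarith)+
  qed
  define T where "T N = nat \<lfloor>s * real (N - 1)\<rfloor>" for N
  have sN: "s * real (N - 1) \<ge> 0" "s * real (N - 1) \<le> real (N - 1)" for N
    using s by (auto intro: mult_left_le_one_le)
  have T1: "real (T N) \<le> s * real (N - 1)" and T2: "real (T N) \<ge> s * real (N - 1) - 1" for N
    unfolding T_def using sN(1)[of N] by linarith+
  have T3: "T N \<le> N - 1" for N using T1[of N] sN(2)[of N] by linarith
  define k1 k2 where "k1 N = (N - 1) * (m - n + c) + T N * (n - c)"
    and "k2 N = (N - 1) * (m - n + c) + (N - 1 - T N) * (n - c)" for N
  define r1 r2 where "r1 = max 0 (R1 - e)" and "r2 = max 0 (R2 - e)"
  define K1 K2 where "K1 N = nat \<lceil>2 powr (real N * r1)\<rceil>" and "K2 N = nat \<lceil>2 powr (real N * r2)\<rceil>" for N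
  have K: "K1 N > 0" "K2 N > 0" for N by (auto simp: K1_def K2_def)
  have "\<exists>co. link_ok C co \<and> M1 co = K1 N \<and> M2 co = K2 N \<and> perfectly_secret m n N co \<and>
     (K1 N \<le> 2 ^ k1 N \<longrightarrow> K2 N \<le> 2 ^ k2 N \<longrightarrow> err_prob m n N co = 0)" for N
    using ex_time_sharing_code[OF nm K T3] by (simp add: k1_def k2_def c_def)
  then obtain co where co: "\<And>N. link_ok C (co N)" "\<And>N. M1 (co N) = K1 N" "\<And>N. M2 (co N) = K2 N"
      "\<And>N. perfectly_secret m n N (co N)"
      "\<And>N. K1 N \<le> 2 ^ k1 N \<Longrightarrow> K2 N \<le> 2 ^ k2 N \<Longrightarrow> err_prob m n N (co N) = 0"
    by metis
  \<comment> \<open>Rounding up costs nothing because \<open>2 ^ k\<close> is an integer.\<close>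
  have fits: "nat \<lceil>2 powr x\<rceil> \<le> 2 ^ k" if "x \<le> real k" for x k
  proof -
    have "2 powr x \<le> 2 powr real k" using that by simp
    then have "2 powr x \<le> real_of_int (2 ^ k)" by (simp add: powr_realpow)
    then have "\<lceil>2 powr x\<rceil> \<le> 2 ^ k" by (simp only: ceiling_le_iff)
    then show ?thesis by (simp add: nat_le_iff)
  qed
  \<comment> \<open>The idle step costs at most \<open>m\<close> bits and the floor in
    \<open>T\<close> at most \<open>d\<close>; from \<open>N0\<close> on, the gain
    \<open>N * e\<close> covers both.\<close>
  obtain N0 :: nat where N0: "real N0 \<ge> (real m + d) / e"
    using real_arch_simple by blast
  have "err_prob m n N (co N) = 0" if N: "N \<ge> N0 + 1" for N
  proof (rule co(5))
    have "(real m + d) / e \<le> real N" using N N0 by linarith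
    then have Ne: "real m + d \<le> real N * e" using e by (simp only: pos_divide_le_eq)
    define L where "L = real (N - 1)"
    have NL: "real N = L + 1" using N by (simp add: L_def)
    have "s * d \<le> d" "(1 - s) * d \<le> d" using s ad by (auto intro: mult_left_le_one_le)
    have "real N * (R1 - e) \<le> real N * (a + s * d) - (real m + d)"
      using Ne mult_left_mono[OF s(3), of "real N"] unfolding right_diff_distrib by linarith
    also have "\<dots> \<le> L * a + (s * L - 1) * d"
      using \<open>s * d \<le> d\<close> ad(3) unfolding NL ad(1)[symmetric] by (simp add: algebra_simps)
    also have "\<dots> \<le> L * a + real (T N) * d"
      using mult_right_mono[OF T2[of N] ad(3)] by (simp add: L_def)
    also have "\<dots> = real (k1 N)" by (simp add: k1_def a_def d_def L_def)
    finally have "real N * r1 \<le> real (k1 N)" by (cases "0 \<le> R1 - e") (simp_all add: r1_def)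
    then show "K1 N \<le> 2 ^ k1 N" unfolding K1_def by (rule fits)
    have "real N * (R2 - e) \<le> real N * (a + (1 - s) * d) - (real m + d)"
      using Ne mult_left_mono[OF s(4), of "real N"] unfolding right_diff_distrib by linarith
    also have "\<dots> \<le> L * a + (L - s * L) * d"
      using \<open>(1 - s) * d \<le> d\<close> ad(3) unfolding NL ad(1)[symmetric] by (simp add: algebra_simps)
    also have "\<dots> \<le> L * a + (L - real (T N)) * d"
      using T1[of N] ad(3) by (intro add_left_mono mult_right_mono) (simp_all add: L_def)
    also have "\<dots> = real (k2 N)"
      unfolding k2_def a_def d_def L_def of_nat_add of_nat_mult of_nat_diff[OF T3] by simp
    finally have "real N * r2 \<le> real (k2 N)" by (cases "0 \<le> R2 - e") (simp_all add: r2_def)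
    then show "K2 N \<le> 2 ^ k2 N" unfolding K2_def by (rule fits)
  qed
  then have "eventually (\<lambda>N. err_prob m n N (co N) = 0) sequentially"
    by (auto simp: eventually_sequentially)
  then have "(\<lambda>N. err_prob m n N (co N)) \<longlonglongrightarrow> 0"
    by (rule tendsto_eventually)
  moreover have "0 \<le> r1" "0 \<le> r2" by (simp_all add: r1_def r2_def)
  ultimately have "achievable m n C (r1, r2)"
    unfolding achievable_def fst_conv snd_conv using co(1-4)
    by (intro conjI exI[of _ co] allI) (auto simp: K1_def K2_def)
  then show ?thesis by (simp only: r1_def r2_def)
qed

section \<open>The capacity region as a closure\<close>

theorem theorem1:
  fixes m n C :: nat
  assumes "m \<ge> 1" and "n \<le> m"
  shows "secrecy_capacity_region m n C =
    {(R1, R2). R1 \<ge> 0 \<and> R2 \<ge> 0 \<and> R1 \<le> real m \<and> R2 \<le> real m \<and>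
               R1 + R2 \<le> 2 * real m - real n + real C}" (is "_ = ?R")
proof
  \<comment> \<open>The outer bound passes to the closure because the region is closed.\<close>
  have "?R = {R. 0 \<le> fst R} \<inter> {R. 0 \<le> snd R} \<inter> {R. fst R \<le> real m} \<inter> {R. snd R \<le> real m} \<inter>
      {R. fst R + snd R \<le> 2 * real m - real n + real C}"
    by auto
  also have "closed \<dots>"
    by (intro closed_Int closed_Collect_le continuous_intros)
  finally have "closed ?R" .
  moreover have "{R. achievable m n C R} \<subseteq> ?R"
    using achievable_imp_bounds[OF assms(2)] by auto
  ultimately show "secrecy_capacity_region m n C \<subseteq> ?R"
    unfolding secrecy_capacity_region_def by (rule closure_minimal[rotated])
  show "?R \<subseteq> secrecy_capacity_region m n C"
  proof clarify
    fix R1 R2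
    assume R: "R1 \<ge> 0" "R2 \<ge> 0" "R1 \<le> real m" "R2 \<le> real m"
      "R1 + R2 \<le> 2 * real m - real n + real C"
    show "(R1, R2) \<in> secrecy_capacity_region m n C"
      unfolding secrecy_capacity_region_def closure_approachable
    proof (intro allI impI)
      fix e :: real assume e: "e > 0"
      \<comment> \<open>Each coordinate moves by at most \<open>e / 3\<close>, so the distance is at
        most \<open>2 * e / 3\<close>.\<close>
      define S where "S = (max 0 (R1 - e / 3), max 0 (R2 - e / 3))"
      have "dist S (R1, R2) \<le> dist (fst S) R1 + dist (snd S) R2"
        unfolding dist_prod_def by (simp add: sqrt_sum_squares_le_sum)
      also have "\<dots> < e" using e R(1,2) by (auto simp: S_def dist_real_def)
      finally have "dist S (R1, R2) < e" .
      moreover have "achievable m n C S"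
        unfolding S_def using e by (intro shrunk_pair_achievable[OF assms(2) R(3-5)]) simp
      ultimately show "\<exists>y\<in>{R. achievable m n C R}. dist y (R1, R2) < e" by blast
    qed
  qed
qed

end
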